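(* Let $n \geq d \geq 5000$ be integers and let $\delta \in (e^{-n}, e^{-1})$. For any estimator $\Phi = \Phi_\delta : \{1,\dots,d\}^n \to \mathcal{P}_d$ (which may depend on $\delta$), there exists a distribution $P \in \mathcal{P}_d$ such that, letting $\widehat P_n = \Phi_\delta(X_1,\dots,X_n)$, $$\mathbb{P}_P\bigg( \mathrm{KL}(P,\widehat P_n) \geq \frac{d + \log(d)\log(1/\delta)}{5000\, n} \bigg) \geq \delta .$$
   Context: $\mathcal{P}_d$ is the set of probability vectors $P=(p_1,\dots,p_d)$ (with $p_j\ge 0$, $\sum_j p_j=1$), identified with probability distributions on $\{1,\dots,d\}$. $X_1,\dots,X_n$ are i.i.d. with distribution $P$ and $\mathbb{P}_P$ is probability under this law. For $P,Q\in\mathcal{P}_d$, $\mathrm{KL}(P,Q)=\sum_{j=1}^d p_j\log(p_j/q_j)\in[0,+\infty]$, with the convention that a term is $0$ if $p_j=0$ and $+\infty$ if $p_j>0=q_j$. $\log$ is the natural logarithm. *)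

theory Defs
  imports "HOL-Probability.Probability"
begin

definition prob_dists :: "nat \<Rightarrow> nat pmf set" where
  "prob_dists d = {P. set_pmf P \<subseteq> {1..d}}"

text \<open>The library's \<open>KL_divergence\<close> is real-valued and hence does not take the value
  \<open>\<infinity>\<close> when absolute continuity fails, so the extended-real version is defined here.\<close>

definition KL :: "nat \<Rightarrow> nat pmf \<Rightarrow> nat pmf \<Rightarrow> ereal" where
  "KL d P Q = (\<Sum>j\<in>{1..d}.
     if pmf P j = 0 then 0
     else if pmf Q j = 0 then \<infinity>
     else ereal (pmf P j * ln (pmf P j / pmf Q j)))"

text \<open>The set \<open>{1,\<dots>,d}\<^sup>n\<close> of possible samples consists of the functions on \<open>{1..n}\<close> that are
  extended by \<open>undefined\<close>, so that \<open>iid_sample n P\<close> is concentrated on it for \<open>P \<in> prob_dists d\<close>.\<close>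

definition samples :: "nat \<Rightarrow> nat \<Rightarrow> (nat \<Rightarrow> nat) set" where
  "samples d n = {1..n} \<rightarrow>\<^sub>E {1..d}"

definition iid_sample :: "nat \<Rightarrow> nat pmf \<Rightarrow> (nat \<Rightarrow> nat) pmf" where
  "iid_sample n P = Pi_pmf {1..n} undefined (\<lambda>_. P)"

end

theory Submission
  imports Defs
begin

text \<open>
  The two terms of the bound come from different families of distributions.

  The term \<open>ln d * ln (1 / \<delta>) / n\<close> is already forced by the constant sample \<open>(1,\<dots>,1)\<close>. With
  \<open>x = ln (1 / \<delta>) / n\<close> and \<open>p = 1 - exp (- x)\<close>, this sample has probability exactly \<open>\<delta>\<close> under every
  distribution giving mass \<open>1 - p\<close> to \<open>1\<close> and mass \<open>p\<close> to some \<open>j > 1\<close>. Let \<open>Q\<close> be the estimate for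
  this sample. If \<open>Q\<close> gives some \<open>j > 1\<close> mass at most \<open>p / sqrt d\<close>, then the distribution for this
  \<open>j\<close> incurs a loss of order \<open>p * ln d\<close>; otherwise \<open>Q\<close> has wasted a mass of order \<open>p * sqrt d\<close>
  outside of \<open>1\<close>, and the point mass at \<open>1\<close> incurs a large loss with probability one.

  The term \<open>d / n\<close> is obtained from the hypercube of distributions on \<open>{1..2 * m}\<close> that give
  the points \<open>i\<close> and \<open>m + i\<close> the masses \<open>(1 \<plusminus> \<epsilon>) / (2 * m)\<close>, where \<open>m = d div 2\<close> and
  \<open>\<epsilon>\<^sup>2 = m / (64 * n)\<close>. An estimate with small loss (measured in squared Hellinger distance, which
  is dominated by \<open>KL\<close>) determines the signs up to a Hamming ball containing an exponentially
  small fraction of the hypercube, whereas the \<open>\<chi>\<^sup>2\<close>-divergence from the uniform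
  distribution shows that the sample carries too little information for this.
\<close>

section \<open>Lower bounds on the divergence\<close>

text \<open>Where \<open>pmf Q j\<close> vanishes but \<open>pmf P j\<close> does not, the term is
  infinite, so real bounds are only asked for at the other points.\<close>

lemma KL_ge_sum:
  assumes zero: "\<And>j. j \<in> {1..d} \<Longrightarrow> pmf P j = 0 \<Longrightarrow> g j \<le> 0"
    and pos: "\<And>j. j \<in> {1..d} \<Longrightarrow> 0 < pmf P j \<Longrightarrow> 0 < pmf Q j
                \<Longrightarrow> g j \<le> pmf P j * ln (pmf P j / pmf Q j)"
  shows "ereal (sum g {1..d}) \<le> KL d P Q"
proof -
  have "ereal (sum g {1..d}) = (\<Sum>j\<in>{1..d}. ereal (g j))"
    by simp
  also have "\<dots> \<le> KL d P Q"
    unfolding KL_def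
  proof (rule sum_mono)
    fix j assume j: "j \<in> {1..d}"
    have "0 < pmf P j" if "pmf P j \<noteq> 0"
      using that pmf_nonneg[of P j] by linarith
    moreover have "0 < pmf Q j" if "pmf Q j \<noteq> 0"
      using that pmf_nonneg[of Q j] by linarith
    ultimately show "ereal (g j) \<le> (if pmf P j = 0 then 0 else if pmf Q j = 0 then \<infinity>
        else ereal (pmf P j * ln (pmf P j / pmf Q j)))"
      using zero[OF j] pos[OF j] by auto
  qed
  finally show ?thesis .
qed

lemma sum_pmf_prob_dists: "P \<in> prob_dists d \<Longrightarrow> (\<Sum>j\<in>{1..d}. pmf P j) = 1"
  by (rule sum_pmf_eq_1) (auto simp: prob_dists_def)

text \<open>This is \<open>ln u \<le> u - 1\<close> at \<open>u = sqrt (q / p)\<close>. The linear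
  part \<open>p - q\<close> cancels when summed over two probability vectors, which leaves the
  squared Hellinger distance.\<close>

lemma entropy_term_ge:
  fixes p q :: real
  assumes "0 < p" "0 < q"
  shows "(sqrt p - sqrt q)\<^sup>2 + p - q \<le> p * ln (p / q)"
proof -
  define u where "u = sqrt q / sqrt p"
  have "ln (p / q) = - 2 * ln u"
    using assms by (simp add: u_def ln_div ln_sqrt)
  moreover have "ln u \<le> u - 1"
    using assms by (intro ln_le_minus_one) (auto simp: u_def)
  ultimately have "2 * (1 - u) \<le> ln (p / q)"
    by (simp add: algebra_simps)
  hence "p * (2 * (1 - u)) \<le> p * ln (p / q)"
    using assms by (intro mult_left_mono) auto
  moreover have "p * (2 * (1 - u)) = 2 * (p - sqrt p * sqrt q)"
  proof -
    have "p * u = sqrt p * sqrt q"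
      using assms by (simp add: u_def field_simps)
    thus ?thesis by (simp add: algebra_simps)
  qed
  moreover have "(sqrt p - sqrt q)\<^sup>2 + p - q = 2 * (p - sqrt p * sqrt q)"
    using assms by (simp add: power2_diff)
  ultimately show ?thesis
    by metis
qed

lemma KL_ge_hellinger:
  assumes "P \<in> prob_dists d" "Q \<in> prob_dists d"
  shows "ereal (\<Sum>j\<in>{1..d}. (sqrt (pmf P j) - sqrt (pmf Q j))\<^sup>2) \<le> KL d P Q"
proof -
  have "(\<Sum>j\<in>{1..d}. (sqrt (pmf P j) - sqrt (pmf Q j))\<^sup>2)
      = (\<Sum>j\<in>{1..d}. (sqrt (pmf P j) - sqrt (pmf Q j))\<^sup>2 + pmf P j - pmf Q j)"
    by (simp add: sum.distrib sum_subtractf sum_pmf_prob_dists[OF assms(1), simplified]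
        sum_pmf_prob_dists[OF assms(2), simplified])
  moreover have "ereal (\<Sum>j\<in>{1..d}. (sqrt (pmf P j) - sqrt (pmf Q j))\<^sup>2 + pmf P j - pmf Q j)
      \<le> KL d P Q"
    by (rule KL_ge_sum) (auto intro!: entropy_term_ge)
  ultimately show ?thesis by simp
qed

text \<open>The estimates \<open>q1 \<le> q2\<close> are ordered opposite to the true masses, so the
  two errors of the square roots together cover the gap \<open>A - B\<close>. That gap is bounded
  below through \<open>(A - B) * (A + B) = e / m\<close>.\<close>

lemma sqrt_pair_ge:
  fixes e m q1 q2 :: real
  assumes "0 \<le> e" "e \<le> 1" "0 < m" "0 \<le> q1" "q1 \<le> q2"
  shows "e\<^sup>2 / (4 * m)
    \<le> (sqrt ((1 + e) / (2 * m)) - sqrt q1)\<^sup>2 + (sqrt ((1 - e) / (2 * m)) - sqrt q2)\<^sup>2"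
proof -
  define A where "A = sqrt ((1 + e) / (2 * m))"
  define B where "B = sqrt ((1 - e) / (2 * m))"
  have A2: "A\<^sup>2 = (1 + e) / (2 * m)" and B2: "B\<^sup>2 = (1 - e) / (2 * m)"
    using assms by (auto simp: A_def B_def)
  have AB: "B \<le> A"
    using assms by (auto simp: A_def B_def divide_right_mono)
  have uv: "sqrt q1 \<le> sqrt q2"
    using assms by simp
  have "(A - B) * (A + B) = A\<^sup>2 - B\<^sup>2"
    by (simp add: power2_eq_square algebra_simps)
  also have "\<dots> = e / m"
    unfolding A2 B2 using assms by (simp add: field_simps)
  finally have "(e / m)\<^sup>2 = ((A - B) * (A + B))\<^sup>2"
    by simp
  also have "\<dots> = (A - B)\<^sup>2 * (A + B)\<^sup>2"
    by (simp add: power_mult_distrib)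
  also have "\<dots> \<le> (A - B)\<^sup>2 * (2 / m)"
  proof (rule mult_left_mono)
    have "0 \<le> (A - B)\<^sup>2" by simp
    hence "(A + B)\<^sup>2 \<le> 2 * (A\<^sup>2 + B\<^sup>2)"
      unfolding power2_diff power2_sum by simp
    also have "\<dots> = 2 / m"
      unfolding A2 B2 using assms by (simp add: field_simps)
    finally show "(A + B)\<^sup>2 \<le> 2 / m" .
  qed simp
  finally have "e\<^sup>2 / (2 * m) \<le> (A - B)\<^sup>2"
    using assms by (simp add: power_divide power2_eq_square field_simps)
  also have "\<dots> \<le> ((A - sqrt q1) + (sqrt q2 - B))\<^sup>2"
    using AB uv by (intro power_mono) auto
  also have "\<dots> \<le> 2 * ((A - sqrt q1)\<^sup>2 + (B - sqrt q2)\<^sup>2)"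
  proof -
    have "0 \<le> ((A - sqrt q1) - (sqrt q2 - B))\<^sup>2" by simp
    thus ?thesis by (simp add: power2_eq_square algebra_simps)
  qed
  finally show ?thesis
    by (simp add: A_def B_def)
qed

section \<open>Independent samples\<close>

lemma exists_pmf:
  fixes f :: "'a \<Rightarrow> real"
  assumes "finite A" "\<And>j. 0 \<le> f j" "\<And>j. j \<notin> A \<Longrightarrow> f j = 0" "sum f A = 1"
  shows "\<exists>P. set_pmf P \<subseteq> A \<and> pmf P = f"
proof -
  have "(\<integral>\<^sup>+x. ennreal (f x) \<partial>count_space UNIV) = (\<Sum>x\<in>A. ennreal (f x))"
    using assms by (intro nn_integral_count_space') auto
  also have "\<dots> = 1"
    using assms by (simp add: sum_ennreal)
  finally have pmf: "pmf (embed_pmf f) = f"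
    using assms by (intro ext pmf_embed_pmf) auto
  hence "set_pmf (embed_pmf f) \<subseteq> A"
    using assms by (auto simp: set_pmf_eq)
  with pmf show ?thesis by blast
qed

lemma prob_iid_sample:
  assumes "finite A" "set_pmf P \<subseteq> A"
  shows "measure_pmf.prob (iid_sample n P) E
    = (\<Sum>x\<in>{1..n} \<rightarrow>\<^sub>E A. indicator E x * (\<Prod>i\<in>{1..n}. pmf P (x i)))"
proof -
  let ?S = "{1..n} \<rightarrow>\<^sub>E A"
  have fin: "finite ?S"
    using assms by (intro finite_PiE) auto
  have "set_pmf (iid_sample n P) \<subseteq> ?S"
    using assms by (auto simp: iid_sample_def set_Pi_pmf PiE_dflt_def PiE_def Pi_def extensional_def)
  hence "measure_pmf.prob (iid_sample n P) E = measure_pmf.prob (iid_sample n P) (?S \<inter> E)"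
    by (intro measure_eq_AE) (auto simp: AE_measure_pmf_iff)
  also have "\<dots> = (\<Sum>x\<in>?S \<inter> E. pmf (iid_sample n P) x)"
    using fin by (simp add: measure_measure_pmf_finite)
  also have "\<dots> = (\<Sum>x\<in>?S. indicator E x * pmf (iid_sample n P) x)"
    using fin by (simp add: sum.inter_restrict indicator_def if_distrib[where f="\<lambda>c. c * _"] cong: if_cong)
  also have "\<dots> = (\<Sum>x\<in>?S. indicator E x * (\<Prod>i\<in>{1..n}. pmf P (x i)))"
  proof (intro sum.cong refl)
    fix x assume "x \<in> ?S"
    hence "x i = undefined" if "i \<notin> {1..n}" for i
      using that by (rule PiE_arb)
    thus "indicator E x * pmf (iid_sample n P) x = indicator E x * (\<Prod>i\<in>{1..n}. pmf P (x i))"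
      unfolding iid_sample_def by (subst pmf_Pi') auto
  qed
  finally show ?thesis .
qed

lemma prob_iid_sample_ge_const:
  assumes "(\<lambda>i\<in>{1..n}. a) \<in> E"
  shows "pmf P a ^ n \<le> measure_pmf.prob (iid_sample n P) E"
proof -
  have "pmf (iid_sample n P) (\<lambda>i\<in>{1..n}. a) = pmf P a ^ n"
    unfolding iid_sample_def by (subst pmf_Pi') auto
  moreover have "measure_pmf.prob (iid_sample n P) {\<lambda>i\<in>{1..n}. a}
      \<le> measure_pmf.prob (iid_sample n P) E"
    using assms by (intro measure_pmf.finite_measure_mono) auto
  ultimately show ?thesis
    by (simp add: measure_pmf_single)
qed

text \<open>
  Second-moment method: with \<open>r\<close> the probability of a sample under \<open>P T\<close> and \<open>u\<close> its probability under
  the uniform distribution, the event indicator \<open>w\<close> satisfies \<open>w * r \<le> (t * r\<^sup>2 / u + w * u / t) / 2\<close>.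
  The first term sums to a power of the \<open>\<chi>\<^sup>2\<close>-divergence plus one, the second is controlled by
  counting.
\<close>

lemma sum_prob_iid_sample_le:
  fixes P :: "'t \<Rightarrow> nat pmf" and G :: "(nat \<Rightarrow> nat) \<Rightarrow> 't \<Rightarrow> bool"
    and c t B :: real
  assumes A: "finite A" "A \<noteq> {}" and F: "finite F" and t: "0 < t"
    and supp: "\<And>T. T \<in> F \<Longrightarrow> set_pmf (P T) \<subseteq> A"
    and chi: "\<And>T. T \<in> F \<Longrightarrow> real (card A) * (\<Sum>a\<in>A. (pmf (P T) a)\<^sup>2) = c"
    and count: "\<And>x. x \<in> {1..n} \<rightarrow>\<^sub>E A \<Longrightarrow> real (card {T\<in>F. G x T}) \<le> B * card F"
  shows "(\<Sum>T\<in>F. measure_pmf.prob (iid_sample n (P T)) {x. G x T})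
    \<le> card F * (t * c ^ n + B / t) / 2"
proof -
  let ?S = "{1..n} \<rightarrow>\<^sub>E A"
  define N where "N = real (card A) ^ n"
  have N: "N > 0"
    using A by (simp add: N_def card_gt_0_iff)
  have cardS: "real (card ?S) = N"
    by (simp add: card_PiE N_def)
  define w where "w x T = (indicator {x. G x T} x :: real)" for x T
  define r where "r x T = (\<Prod>i\<in>{1..n}. pmf (P T) (x i))" for x T
  \<comment> \<open>For \<open>w x T = 1\<close> this is AM-GM with \<open>1 / N\<close> as the
    uniform probability; for \<open>w x T = 0\<close> only nonnegativity is left.\<close>
  have amgm: "w x T * r x T \<le> (t * N * (r x T)\<^sup>2 + w x T / (t * N)) / 2" for x T
  proof -
    have "0 \<le> (t * N * r x T - 1)\<^sup>2 / (t * N)"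
      using N t by simp
    also have "\<dots> = t * N * (r x T)\<^sup>2 - 2 * r x T + 1 / (t * N)"
      using N t by (simp add: power2_eq_square field_simps)
    finally have "2 * r x T \<le> t * N * (r x T)\<^sup>2 + 1 / (t * N)" by simp
    moreover have "0 \<le> t * N * (r x T)\<^sup>2"
      using N t by simp
    ultimately show ?thesis
      by (auto simp: w_def indicator_def)
  qed
  have second: "N * (\<Sum>x\<in>?S. (r x T)\<^sup>2) = c ^ n" if T: "T \<in> F" for T
  proof -
    have "(\<Sum>x\<in>?S. (r x T)\<^sup>2) = (\<Sum>x\<in>?S. \<Prod>i\<in>{1..n}. (pmf (P T) (x i))\<^sup>2)"
      by (simp add: r_def prod_power_distrib)
    also have "\<dots> = (\<Prod>i\<in>{1..n}. \<Sum>a\<in>A. (pmf (P T) a)\<^sup>2)"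
      using A by (subst prod_sum_PiE) auto
    finally show ?thesis
      by (simp add: N_def chi[OF T, symmetric] power_mult_distrib)
  qed
  have wsum: "(\<Sum>T\<in>F. w x T) = card {T\<in>F. G x T}" for x
    using F by (simp add: w_def indicator_def sum.If_cases Int_def)
  have "(\<Sum>T\<in>F. measure_pmf.prob (iid_sample n (P T)) {x. G x T}) = (\<Sum>T\<in>F. \<Sum>x\<in>?S. w x T * r x T)"
    unfolding w_def r_def by (intro sum.cong refl) (subst prob_iid_sample[OF A(1) supp], auto)
  also have "\<dots> \<le> (\<Sum>T\<in>F. \<Sum>x\<in>?S. (t * N * (r x T)\<^sup>2 + w x T / (t * N)) / 2)"
    by (intro sum_mono amgm)
  also have "\<dots> = ((\<Sum>T\<in>F. t * (N * (\<Sum>x\<in>?S. (r x T)\<^sup>2))) + (\<Sum>T\<in>F. \<Sum>x\<in>?S. w x T / (t * N))) / 2"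
    by (simp add: sum_divide_distrib[symmetric] sum.distrib sum_distrib_left mult.assoc)
  also have "(\<Sum>T\<in>F. t * (N * (\<Sum>x\<in>?S. (r x T)\<^sup>2))) = card F * (t * c ^ n)"
    using second by simp
  also have "(\<Sum>T\<in>F. \<Sum>x\<in>?S. w x T / (t * N)) = (\<Sum>x\<in>?S. (\<Sum>T\<in>F. w x T)) / (t * N)"
    by (subst sum.swap) (simp add: sum_divide_distrib)
  also have "(\<Sum>x\<in>?S. (\<Sum>T\<in>F. w x T)) \<le> (\<Sum>x\<in>?S. B * card F)"
    unfolding wsum by (intro sum_mono count)
  also have "\<dots> = N * (B * card F)"
    using cardS by simp
  finally have "(\<Sum>T\<in>F. measure_pmf.prob (iid_sample n (P T)) {x. G x T})
      \<le> (card F * (t * c ^ n) + N * (B * card F) / (t * N)) / 2"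
    using N t by (simp add: divide_right_mono)
  also have "\<dots> = card F * (t * c ^ n + B / t) / 2"
    using N t by (simp add: field_simps)
  finally show ?thesis .
qed

section \<open>The hypercube family\<close>

text \<open>Chernoff bound: each set in the ball has
  \<open>exp (- h T) \<ge> exp (- card I / 8)\<close>, while the sum of \<open>exp (- h T)\<close>
  over all subsets factors into \<open>(1 + exp (- 1)) ^ card I\<close>, and
  \<open>1 + exp (- 1) \<le> 3 / 2 \<le> 2 * exp (- 1 / 4)\<close>.\<close>

lemma card_hamming_ball_le:
  assumes "finite I"
  shows "real (card {T\<in>Pow I. 8 * card {i\<in>I. (i \<in> T) \<noteq> (i \<in> S)} \<le> card I})
    \<le> exp (- real (card I) / 8) * card (Pow I)"
proof -
  define h where "h T = card {i\<in>I. (i \<in> T) \<noteq> (i \<in> S)}" for T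
  let ?B = "{T\<in>Pow I. 8 * h T \<le> card I}"
  define c where "c = exp (-1::real)"
  have c_half: "c \<le> 1 / 2"
    using exp_ge_add_one_self[of 1] by (simp add: c_def exp_minus field_simps)
  have quarter: "3 / 4 \<le> exp (- 1 / 4 :: real)"
    using exp_ge_add_one_self[of "- 1 / 4"] by simp
  \<comment> \<open>A point \<open>i\<close> contributes \<open>f i\<close> if it lies in
    \<open>T\<close> and \<open>g i\<close> otherwise; this factor is \<open>c\<close> exactly when
    \<open>T\<close> and \<open>S\<close> disagree at \<open>i\<close>.\<close>
  define f g where "f i = (if i \<in> S then 1 else c)" and "g i = (if i \<in> S then c else 1)" for i
  have prod: "prod f T * prod g (I - T) = exp (- real (h T))" if "T \<in> Pow I" for T
  proof -
    have fin: "finite T" "finite (I - T)"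
      using that assms by (auto intro: finite_subset)
    have "prod f T = c ^ card (T - S)"
      using fin by (simp add: f_def prod.If_cases Diff_eq)
    moreover have "prod g (I - T) = c ^ card ((I - T) \<inter> S)"
      using fin by (simp add: g_def prod.If_cases Int_def)
    moreover have "h T = card (T - S) + card ((I - T) \<inter> S)"
      unfolding h_def using that fin
      by (subst card_Un_disjoint[symmetric]) (auto intro!: arg_cong[of _ _ card])
    ultimately show ?thesis
      by (simp add: c_def exp_of_nat_mult[symmetric] exp_add[symmetric])
  qed
  have "real (card ?B) * exp (- real (card I) / 8) = (\<Sum>T\<in>?B. exp (- real (card I) / 8))"
    by simp
  also have "\<dots> \<le> (\<Sum>T\<in>?B. exp (- real (h T)))"
    by (intro sum_mono) auto
  also have "\<dots> \<le> (\<Sum>T\<in>Pow I. exp (- real (h T)))"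
    using assms by (intro sum_mono2) auto
  also have "\<dots> = (\<Prod>i\<in>I. f i + g i)"
    unfolding prod_add[OF assms] by (intro sum.cong refl) (simp add: prod)
  also have "\<dots> = (1 + c) ^ card I"
    by (simp add: f_def g_def add.commute if_distrib cong: if_cong)
  also have "\<dots> \<le> (2 * exp (- 1 / 4)) ^ card I"
    using c_half quarter by (intro power_mono) (auto simp: c_def)
  also have "\<dots> = card (Pow I) * exp (- real (card I) / 4)"
    using assms by (simp add: power_mult_distrib card_Pow exp_of_nat_mult[symmetric])
  also have "exp (- real (card I) / 4) = exp (- real (card I) / 8) * exp (- real (card I) / 8)"
    by (simp add: exp_add[symmetric])
  finally have "real (card ?B) \<le> card (Pow I) * exp (- real (card I) / 8)"
    by (simp add: mult.assoc[symmetric])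
  thus ?thesis
    by (simp add: h_def mult.commute)
qed

lemma sum_two_halves:
  fixes f :: "nat \<Rightarrow> 'a :: comm_monoid_add"
  shows "(\<Sum>j\<in>{1..2*m}. f j) = (\<Sum>i\<in>{1..m}. f i + f (m + i))"
proof -
  have "(\<Sum>j\<in>{1..2*m}. f j) = (\<Sum>j\<in>{1..m}. f j) + (\<Sum>j\<in>{m+1..m+m}. f j)"
    by (subst sum.union_disjoint[symmetric]) (auto intro!: sum.cong)
  also have "(\<Sum>j\<in>{m+1..m+m}. f j) = (\<Sum>i\<in>{1..m}. f (m + i))"
    using sum.shift_bounds_cl_nat_ivl[of f 1 m m] by (simp add: add.commute)
  finally show ?thesis by (simp add: sum.distrib)
qed

text \<open>\<open>T\<close> is the set of positive signs. Opposite perturbations at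
  \<open>i\<close> and \<open>m + i\<close> keep the total mass at 1 whatever \<open>T\<close> is,
  so the signs vary freely.\<close>

definition cube_mass :: "nat \<Rightarrow> real \<Rightarrow> nat set \<Rightarrow> nat \<Rightarrow> real" where
  "cube_mass m e T j =
    (if j \<in> {1..m} then (if j \<in> T then 1 + e else 1 - e) / (2 * real m)
     else if j \<in> {m+1..2*m} then (if j - m \<in> T then 1 - e else 1 + e) / (2 * real m)
     else 0)"

definition cube_pmf :: "nat \<Rightarrow> real \<Rightarrow> nat set \<Rightarrow> nat pmf" where
  "cube_pmf m e T = (SOME P. set_pmf P \<subseteq> {1..2*m} \<and> pmf P = cube_mass m e T)"

lemma cube_pmf:
  assumes "0 < m" "0 \<le> e" "e \<le> 1"
  shows "set_pmf (cube_pmf m e T) \<subseteq> {1..2*m}" "pmf (cube_pmf m e T) = cube_mass m e T"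
proof -
  have "(\<Sum>j\<in>{1..2*m}. cube_mass m e T j) = (\<Sum>i\<in>{1..m}. 1 / m)"
    unfolding sum_two_halves using assms
    by (intro sum.cong refl) (auto simp: cube_mass_def field_simps)
  hence "\<exists>P. set_pmf P \<subseteq> {1..2*m} \<and> pmf P = cube_mass m e T"
    using assms by (intro exists_pmf) (auto simp: cube_mass_def)
  from someI_ex[OF this]
  show "set_pmf (cube_pmf m e T) \<subseteq> {1..2*m}" "pmf (cube_pmf m e T) = cube_mass m e T"
    by (auto simp: cube_pmf_def)
qed

text \<open>The excess \<open>e\<^sup>2\<close> is the chi-square divergence from the uniform
  distribution. It is the same for all \<open>T\<close>, as the common \<open>c\<close> in
  \<open>sum_prob_iid_sample_le\<close> requires.\<close>

lemma sum_cube_mass_squared: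
  assumes "0 < m"
  shows "real (card {1..2*m}) * (\<Sum>j\<in>{1..2*m}. (cube_mass m e T j)\<^sup>2) = 1 + e\<^sup>2"
proof -
  have "(\<Sum>j\<in>{1..2*m}. (cube_mass m e T j)\<^sup>2) = (\<Sum>i\<in>{1..m}. (1 + e\<^sup>2) / (2 * (real m)\<^sup>2))"
    unfolding sum_two_halves using assms
    by (intro sum.cong refl) (auto simp: cube_mass_def power2_eq_square field_simps)
  also have "\<dots> = (1 + e\<^sup>2) / (2 * real m)"
    using assms by (simp add: power2_eq_square)
  finally show ?thesis
    using assms by simp
qed

text \<open>The sign at \<open>i\<close> is decoded from \<open>Q\<close> by comparing
  \<open>pmf Q i\<close> with \<open>pmf Q (m + i)\<close>. By \<open>sqrt_pair_ge\<close>, each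
  wrong sign costs \<open>e\<^sup>2 / (4 * m)\<close> in squared Hellinger distance, and the pairs
  are disjoint.\<close>

lemma KL_cube_pmf_ge:
  assumes m: "0 < m" "2 * m \<le> d" and e: "0 \<le> e" "e \<le> 1" and Q: "Q \<in> prob_dists d"
  shows "ereal (card {i\<in>{1..m}. (i \<in> T) \<noteq> (pmf Q (m + i) < pmf Q i)} * (e\<^sup>2 / (4 * real m)))
    \<le> KL d (cube_pmf m e T) Q"
proof -
  note cube = cube_pmf[OF m(1) e, of T]
  define D where "D j = (sqrt (cube_mass m e T j) - sqrt (pmf Q j))\<^sup>2" for j
  let ?M = "{i\<in>{1..m}. (i \<in> T) \<noteq> (pmf Q (m + i) < pmf Q i)}"
  have pair: "e\<^sup>2 / (4 * real m) \<le> D i + D (m + i)" if "i \<in> ?M" for i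
    using that m e sqrt_pair_ge[of e m "pmf Q i" "pmf Q (m + i)"]
      sqrt_pair_ge[of e m "pmf Q (m + i)" "pmf Q i"]
    by (auto simp: D_def cube_mass_def)
  have "card ?M * (e\<^sup>2 / (4 * real m)) = (\<Sum>i\<in>?M. e\<^sup>2 / (4 * real m))"
    by simp
  also have "\<dots> \<le> (\<Sum>i\<in>?M. D i + D (m + i))"
    by (intro sum_mono pair)
  also have "\<dots> \<le> (\<Sum>i\<in>{1..m}. D i + D (m + i))"
    by (intro sum_mono2) (auto simp: D_def)
  also have "\<dots> = (\<Sum>j\<in>{1..2*m}. D j)"
    by (rule sum_two_halves[symmetric])
  also have "\<dots> \<le> (\<Sum>j\<in>{1..d}. D j)"
    using m by (intro sum_mono2) (auto simp: D_def)
  finally have "ereal (card ?M * (e\<^sup>2 / (4 * real m))) \<le> ereal (\<Sum>j\<in>{1..d}. D j)"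
    by simp
  also have "\<dots> \<le> KL d (cube_pmf m e T) Q"
    using KL_ge_hellinger[OF _ Q, of "cube_pmf m e T"] cube m
    by (force simp: prob_dists_def D_def)
  finally show ?thesis .
qed

text \<open>Otherwise, for every \<open>T\<close>, the decoded signs have at most
  \<open>m / 8\<close> errors with probability above \<open>1 / 2\<close>; summing over the
  hypercube contradicts \<open>sum_prob_iid_sample_le\<close>.\<close>

lemma dimension_lower_bound:
  assumes n: "d \<le> n" and d: "5000 \<le> d" and \<Phi>: "\<Phi> \<in> samples d n \<rightarrow> prob_dists d"
  shows "\<exists>P\<in>prob_dists d. 1 / 2 \<le>
    measure_pmf.prob (iid_sample n P) {X. ereal (real d / (4950 * real n)) \<le> KL d P (\<Phi> X)}"
proof (rule ccontr)
  define m where "m = d div 2"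
  have m: "2500 \<le> m" "2 * m \<le> d" "d \<le> 2 * m + 1"
    using d by (auto simp: m_def)
  have m0: "0 < m" and n0: "0 < n"
    using m n d by auto
  \<comment> \<open>This makes \<open>n * e\<^sup>2 = m / 64\<close>, so
    \<open>(1 + e\<^sup>2) ^ n \<le> exp (m / 64)\<close> is too small to compensate the ball
    fraction \<open>exp (- m / 8)\<close>; \<open>d \<le> n\<close> ensures
    \<open>e \<le> 1\<close>.\<close>
  define e where "e = sqrt (real m / (64 * real n))"
  have e2: "e\<^sup>2 = real m / (64 * real n)"
    by (simp add: e_def)
  have e: "0 \<le> e" "e \<le> 1"
    using m n n0 by (auto simp: e_def)
  define r where "r = real d / (4950 * real n)"
  define P where "P = cube_pmf m e"
  define S where "S X = {i. pmf (\<Phi> X) (m + i) < pmf (\<Phi> X) i}" for X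
  define G where "G X T \<longleftrightarrow> 8 * card {i\<in>{1..m}. (i \<in> T) \<noteq> (i \<in> S X)} \<le> card {1..m}" for X T
  let ?F = "Pow {1..m}"
  assume "\<not> ?thesis"
  hence small: "measure_pmf.prob (iid_sample n Q) {X. ereal r \<le> KL d Q (\<Phi> X)} < 1 / 2"
    if "Q \<in> prob_dists d" for Q
    using that by (auto simp: r_def not_le)
  have PT: "set_pmf (P T) \<subseteq> {1..2*m}" "P T \<in> prob_dists d" for T
    using cube_pmf(1)[OF m0 e, of T] m by (auto simp: P_def prob_dists_def)
  have supp: "set_pmf (iid_sample n (P T)) \<subseteq> samples d n" for T
    using PT(2)[of T]
    by (auto simp: iid_sample_def samples_def prob_dists_def set_Pi_pmf PiE_dflt_def PiE_def Pi_def
        extensional_def)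
  have success: "1 / 2 < measure_pmf.prob (iid_sample n (P T)) {X. G X T}" for T
  proof -
    have "KL d (P T) (\<Phi> X) < ereal r \<Longrightarrow> G X T" if X: "X \<in> samples d n" for X
    proof (rule ccontr)
      assume less: "KL d (P T) (\<Phi> X) < ereal r" and "\<not> G X T"
      define k where "k = card {i\<in>{1..m}. (i \<in> T) \<noteq> (pmf (\<Phi> X) (m + i) < pmf (\<Phi> X) i)}"
      have k: "m < 8 * k"
        using \<open>\<not> G X T\<close> by (simp add: G_def S_def k_def)
      have "ereal (k * (e\<^sup>2 / (4 * real m))) < ereal r"
        using KL_cube_pmf_ge[OF m0 m(2) e, of "\<Phi> X" T] less X \<Phi> unfolding P_def k_def
        by (intro le_less_trans[OF _ less[unfolded P_def]]) auto
      \<comment> \<open>Each of the more than \<open>m / 8\<close> errors costs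
        \<open>1 / (256 * n)\<close>; \<open>4950 / 8 > 2 * 256\<close> leaves room for the extra
        point when \<open>d\<close> is odd.\<close>
      hence "real k / (256 * real n) < real d / (4950 * real n)"
        using m0 by (simp add: e2 r_def)
      hence "4950 * real k < 256 * real d"
        using n0 by (simp add: field_simps)
      thus False
        using k m by linarith
    qed
    hence "measure_pmf.prob (iid_sample n (P T)) (- {X. ereal r \<le> KL d (P T) (\<Phi> X)})
        \<le> measure_pmf.prob (iid_sample n (P T)) {X. G X T}"
      using supp[of T] by (intro measure_pmf.finite_measure_mono_AE) (auto simp: AE_measure_pmf_iff not_le)
    moreover have "measure_pmf.prob (iid_sample n (P T)) (- {X. ereal r \<le> KL d (P T) (\<Phi> X)})
        = 1 - measure_pmf.prob (iid_sample n (P T)) {X. ereal r \<le> KL d (P T) (\<Phi> X)}"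
      using measure_pmf.prob_compl[of "{X. ereal r \<le> KL d (P T) (\<Phi> X)}" "iid_sample n (P T)"]
      by (simp add: Compl_eq_Diff_UNIV)
    ultimately show ?thesis
      using small[OF PT(2), of T] by linarith
  qed
  have "card ?F / 2 = (\<Sum>T\<in>?F. 1 / 2)"
    by simp
  also have "\<dots> < (\<Sum>T\<in>?F. measure_pmf.prob (iid_sample n (P T)) {X. G X T})"
    by (intro sum_strict_mono success) auto
  \<comment> \<open>\<open>t = exp (- m / 16)\<close> is the square root of the ball fraction
    \<open>B = exp (- m / 8)\<close>, so both \<open>t * c ^ n\<close> and \<open>B / t\<close> are
    exponentially small.\<close>
  also have "\<dots> \<le> card ?F * (exp (- real m / 16) * (1 + e\<^sup>2) ^ n + exp (- real m / 8) / exp (- real m / 16)) / 2"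
  proof (rule sum_prob_iid_sample_le)
    show "real (card {T\<in>?F. G X T}) \<le> exp (- real m / 8) * card ?F" for X
      using card_hamming_ball_le[of "{1..m}" "S X"] by (simp add: G_def)
    show "real (card {1..2*m}) * (\<Sum>a\<in>{1..2*m}. (pmf (P T) a)\<^sup>2) = 1 + e\<^sup>2" for T
      using sum_cube_mass_squared[OF m0] by (simp add: P_def cube_pmf(2)[OF m0 e])
  qed (use PT m0 in auto)
  finally have "1 < exp (- real m / 16) * (1 + e\<^sup>2) ^ n + exp (- real m / 8) / exp (- real m / 16)"
    by (simp add: card_Pow)
  also have "\<dots> \<le> exp (- real m / 16) * exp (real m / 64) + exp (- real m / 8) / exp (- real m / 16)"
  proof (intro add_right_mono mult_left_mono)
    have "(1 + e\<^sup>2) ^ n \<le> exp (e\<^sup>2) ^ n"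
      by (intro power_mono exp_ge_add_one_self) auto
    also have "\<dots> = exp (real m / 64)"
      using n0 by (simp add: exp_of_nat_mult[symmetric] e2)
    finally show "(1 + e\<^sup>2) ^ n \<le> exp (real m / 64)" .
  qed simp
  also have "\<dots> = exp (- 3 * real m / 64) + exp (- real m / 16)"
    by (simp add: exp_add[symmetric] exp_diff[symmetric])
  also have "\<dots> \<le> exp (- 1) + exp (- 1)"
    using m by (intro add_mono) auto
  also have "\<dots> \<le> (1::real)"
    using exp_ge_add_one_self[of 1] by (simp add: exp_minus field_simps)
  finally show False by simp
qed

section \<open>The constant sample\<close>

text \<open>The point \<open>j\<close> contributes at least \<open>p * ln (sqrt d)\<close>. The
  point 1 can take back at most \<open>p\<close>, since \<open>pmf Q 1 \<le> 1\<close> and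
  \<open>(1 - p) * ln (1 - p) \<ge> - p\<close>.\<close>

lemma KL_two_point_ge:
  assumes P: "set_pmf P \<subseteq> {1, j}" "pmf P 1 = 1 - p" "pmf P j = p"
    and j: "j \<in> {2..d}" and p: "0 < p" "p < 1"
    and d: "0 < d" and q: "pmf Q j \<le> p / sqrt d"
  shows "ereal (p * (ln d / 2 - 1)) \<le> KL d P Q"
proof -
  define g where "g k = (if k = 1 then - p else if k = j then p * (ln d / 2) else 0)" for k
  have "(\<Sum>k\<in>{1..d}. g k) = (\<Sum>k\<in>{1,j}. g k)"
    using j by (intro sum.mono_neutral_right) (auto simp: g_def)
  also have "\<dots> = p * (ln d / 2 - 1)"
    using j by (simp add: g_def algebra_simps)
  finally have "(\<Sum>k\<in>{1..d}. g k) = p * (ln d / 2 - 1)" .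
  moreover have "ereal (\<Sum>k\<in>{1..d}. g k) \<le> KL d P Q"
  proof (rule KL_ge_sum)
    fix k assume k: "k \<in> {1..d}" "pmf P k = 0"
    thus "g k \<le> 0"
      using P p by (auto simp: g_def)
  next
    fix k assume k: "k \<in> {1..d}" "0 < pmf P k" "0 < pmf Q k"
    have "k \<in> {1, j}"
      using P k by (auto simp: pmf_positive_iff)
    moreover have "- p \<le> (1 - p) * ln ((1 - p) / pmf Q 1)" if "k = 1"
    proof -
      have q1: "0 < pmf Q 1" "pmf Q 1 \<le> 1"
        using k that by (auto simp: pmf_le_1)
      have "1 - inverse (1 - p) \<le> ln (1 - p)"
        using ln_le_minus_one[of "inverse (1 - p)"] p by (simp add: ln_inverse)
      also have "\<dots> \<le> ln ((1 - p) / pmf Q 1)"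
        using q1 p by (simp add: ln_div)
      finally have "(1 - p) * (1 - inverse (1 - p)) \<le> (1 - p) * ln ((1 - p) / pmf Q 1)"
        using p by (intro mult_left_mono) auto
      moreover have "(1 - p) * (1 - inverse (1 - p)) = - p"
        using p by (simp add: field_simps)
      ultimately show ?thesis by simp
    qed
    moreover have "p * (ln d / 2) \<le> p * ln (p / pmf Q j)" if "k = j"
    proof (rule mult_left_mono)
      have qj: "0 < pmf Q j"
        using k that by simp
      have "ln d / 2 = ln (sqrt d)"
        using d by (simp add: ln_sqrt)
      also have "\<dots> \<le> ln (p / pmf Q j)"
        using q qj d p by (intro ln_mono) (auto simp: field_simps)
      finally show "ln d / 2 \<le> ln (p / pmf Q j)" .
    qed (use p in simp)
    ultimately show "g k \<le> pmf P k * ln (pmf P k / pmf Q k)"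
      using P j by (auto simp: g_def)
  qed
  ultimately show ?thesis by simp
qed

text \<open>The mass that \<open>Q\<close> places on \<open>{2..d}\<close> is missing at 1, and
  \<open>- ln q \<ge> 1 - q\<close> turns it into loss.\<close>

lemma KL_return_ge:
  assumes d: "1 \<le> d" and Q: "Q \<in> prob_dists d"
    and s: "\<And>j. j \<in> {2..d} \<Longrightarrow> s \<le> pmf Q j"
  shows "ereal ((real d - 1) * s) \<le> KL d (return_pmf 1) Q"
proof -
  define g where "g k = (if k = 1 then (real d - 1) * s else 0)" for k :: nat
  have "{1..d} = insert 1 {2..d}"
    using d by auto
  hence "1 = pmf Q 1 + (\<Sum>j\<in>{2..d}. pmf Q j)"
    using sum_pmf_prob_dists[OF Q] by simp
  moreover have "(real d - 1) * s \<le> (\<Sum>j\<in>{2..d}. pmf Q j)"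
    using sum_mono[of "{2..d}" "\<lambda>_. s" "pmf Q"] s d by (simp add: of_nat_diff)
  ultimately have q1: "pmf Q 1 \<le> 1 - (real d - 1) * s"
    by linarith
  have "ereal (\<Sum>k\<in>{1..d}. g k) \<le> KL d (return_pmf 1) Q"
  proof (rule KL_ge_sum)
    fix k assume k: "0 < pmf (return_pmf 1) k" "0 < pmf Q k"
    hence "k = 1"
      by (auto simp: pmf_return indicator_def split: if_splits)
    moreover have "(real d - 1) * s \<le> - ln (pmf Q 1)"
      using ln_le_minus_one[of "pmf Q 1"] k(2) \<open>k = 1\<close> q1 by simp
    ultimately show "g k \<le> pmf (return_pmf 1) k * ln (pmf (return_pmf 1) k / pmf Q k)"
      using k by (simp add: g_def ln_div)
  qed (auto simp: g_def pmf_return indicator_def split: if_splits)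
  moreover have "(\<Sum>k\<in>{1..d}. g k) = (real d - 1) * s"
    using d by (simp add: g_def)
  ultimately show ?thesis by simp
qed

text \<open>Absorbs the \<open>- 1\<close> of \<open>KL_two_point_ge\<close>:
  \<open>l \<ge> 4\<close> gives \<open>l / 2 - 1 \<ge> l / 4\<close>.\<close>

lemma ln_ge_4:
  assumes "5000 \<le> (x::real)"
  shows "4 \<le> ln x"
proof -
  have "exp (4::real) = exp 1 ^ 4"
    by (simp add: exp_of_nat_mult[symmetric])
  also have "\<dots> \<le> 3 ^ 4"
    using exp_le by (intro power_mono) auto
  also have "\<dots> \<le> x"
    using assms by simp
  finally show ?thesis
    using assms by (simp add: ln_ge_iff)
qed

lemma confidence_lower_bound:
  assumes n: "0 < n" and d: "5000 \<le> d"
    and \<delta>: "\<delta> \<in> {exp (- real n)<..<1}"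
    and \<Phi>: "\<Phi> \<in> samples d n \<rightarrow> prob_dists d"
  shows "\<exists>P\<in>prob_dists d. \<delta> \<le>
    measure_pmf.prob (iid_sample n P)
      {X. ereal (ln d * ln (1 / \<delta>) / (8 * real n)) \<le> KL d P (\<Phi> X)}"
proof -
  define x where "x = ln (1 / \<delta>) / n"
  have \<delta>0: "0 < \<delta>"
    using \<delta> by (auto intro: less_trans[OF exp_gt_zero])
  have "ln (exp (- real n)) < ln \<delta>"
    using \<delta> \<delta>0 by (subst ln_less_cancel_iff) auto
  hence x1: "x < 1" and x0: "0 < x"
    using n \<delta> \<delta>0 by (auto simp: x_def ln_div divide_simps)
  define p where "p = 1 - exp (- x)"
  have p: "0 < p" "p < 1"
    using x0 by (auto simp: p_def)
  have "(1 - p) ^ n = exp (- (n * x))"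
    by (simp add: p_def exp_of_nat_mult[symmetric])
  hence power: "(1 - p) ^ n = \<delta>"
    using n \<delta>0 by (simp add: x_def ln_div)
  \<comment> \<open>For \<open>0 < x < 1\<close>, \<open>(1 + x) * (1 - x / 2) \<ge> 1\<close>; the
    bound \<open>x < 1\<close> comes from \<open>\<delta> > exp (- n)\<close>.\<close>
  have p_ge: "x / 2 \<le> p"
  proof -
    have "exp (- x) \<le> inverse (1 + x)"
      using exp_ge_add_one_self[of x] x0 by (simp add: exp_minus le_imp_inverse_le)
    also have "\<dots> \<le> 1 - x / 2"
      using x0 x1 mult_right_mono[of x 1 x] by (simp add: field_simps)
    finally show ?thesis by (simp add: p_def)
  qed
  define l where "l = ln (real d)"
  have l: "4 \<le> l"
    using ln_ge_4[of d] d by (simp add: l_def)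
  define r where "r = ln d * ln (1 / \<delta>) / (8 * real n)"
  have r: "r = x * l / 8"
    by (simp add: r_def x_def l_def mult_ac)
  have r_le: "r \<le> p * (l / 4)"
    using mult_right_mono[OF p_ge, of "l / 4"] l by (simp add: r)
  define X where "X = (\<lambda>i\<in>{1..n}. 1 :: nat)"
  have "X \<in> samples d n"
    using d by (auto simp: X_def samples_def)
  hence Q: "\<Phi> X \<in> prob_dists d"
    using \<Phi> by auto
  show ?thesis
  proof (cases "\<exists>j\<in>{2..d}. pmf (\<Phi> X) j \<le> p / sqrt d")
    case True
    then obtain j where j: "j \<in> {2..d}" "pmf (\<Phi> X) j \<le> p / sqrt d"
      by blast
    define f where "f k = (if k = 1 then 1 - p else if k = j then p else 0)" for k
    have "\<exists>P. set_pmf P \<subseteq> {1, j} \<and> pmf P = f"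
      using p j by (intro exists_pmf) (auto simp: f_def)
    then obtain P where P: "set_pmf P \<subseteq> {1, j}" "pmf P = f"
      by blast
    have "r \<le> p * (l / 4)"
      by (rule r_le)
    also have "\<dots> \<le> p * (l / 2 - 1)"
      using p l by (intro mult_left_mono) auto
    finally have "ereal r \<le> ereal (p * (l / 2 - 1))" by simp
    also have "\<dots> \<le> KL d P (\<Phi> X)"
      unfolding l_def using P p j d by (intro KL_two_point_ge) (auto simp: f_def)
    finally have "pmf P 1 ^ n \<le> measure_pmf.prob (iid_sample n P) {X. ereal r \<le> KL d P (\<Phi> X)}"
      by (intro prob_iid_sample_ge_const) (simp add: X_def)
    moreover have "P \<in> prob_dists d"
      using P j by (auto simp: prob_dists_def)
    ultimately show ?thesis
      using P power unfolding r_def f_def by auto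
  next
    case False
    let ?P = "return_pmf 1 :: nat pmf"
    have sqrt_d: "0 < sqrt d" "sqrt d * sqrt d = d"
      using d by auto
    have "l / 2 = ln (sqrt d)"
      using d by (simp add: l_def ln_sqrt)
    also have "\<dots> \<le> sqrt d"
      using sqrt_d ln_le_minus_one[of "sqrt d"] by simp
    finally have "p * (l / 4) \<le> p * (sqrt d / 2)"
      using p by (intro mult_left_mono) auto
    also have "\<dots> = (real d / 2) * (p / sqrt d)"
      using sqrt_d by (simp add: field_simps)
    also have "\<dots> \<le> (real d - 1) * (p / sqrt d)"
      using d p by (intro mult_right_mono) auto
    finally have "ereal r \<le> ereal ((real d - 1) * (p / sqrt d))"
      unfolding ereal_less_eq(3) using r_le by (rule order_trans[rotated])
    also have "\<dots> \<le> KL d ?P (\<Phi> X)"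
      using False d Q by (intro KL_return_ge) (auto simp: not_le intro: less_imp_le)
    \<comment> \<open>Under the point mass the constant sample is certain, so the left side is 1,
      which exceeds \<open>\<delta>\<close>.\<close>
    finally have "pmf ?P 1 ^ n \<le> measure_pmf.prob (iid_sample n ?P) {X. ereal r \<le> KL d ?P (\<Phi> X)}"
      by (intro prob_iid_sample_ge_const) (simp add: X_def)
    moreover have "?P \<in> prob_dists d"
      using d by (simp add: prob_dists_def)
    ultimately show ?thesis
      using \<delta> unfolding r_def by (intro bexI[of _ ?P]) auto
  qed
qed

section \<open>Combination of the two lower bounds\<close>

theorem theorem4:
  fixes n d :: nat and \<delta> :: real and \<Phi> :: "(nat \<Rightarrow> nat) \<Rightarrow> nat pmf"
  assumes "n \<ge> d" and "d \<ge> 5000"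
    and "\<delta> \<in> {exp (- real n)<..<exp (- 1)}"
    and "\<Phi> \<in> samples d n \<rightarrow> prob_dists d"
  shows "\<exists>P\<in>prob_dists d.
    measure_pmf.prob (iid_sample n P)
      {X. KL d P (\<Phi> X) \<ge>
        ereal ((real d + ln (real d) * ln (1 / \<delta>)) / (5000 * real n))} \<ge> \<delta>"
proof -
  define r where "r = (real d + ln (real d) * ln (1 / \<delta>)) / (5000 * real n)"
  have n: "0 < n"
    using assms by simp
  \<comment> \<open>The dimension bound holds with probability \<open>1 / 2\<close>, which suffices
    because \<open>\<delta> < exp (- 1) \<le> 1 / 2\<close>.\<close>
  have half: "exp (- 1 :: real) \<le> 1 / 2"
    using exp_ge_add_one_self[of 1] by (simp add: exp_minus field_simps)
  have weaken: ?thesis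
    if ex: "\<exists>P\<in>prob_dists d. \<eta> \<le> measure_pmf.prob (iid_sample n P) {X. ereal s \<le> KL d P (\<Phi> X)}"
      and "r \<le> s" and "\<delta> \<le> \<eta>" for s \<eta>
  proof -
    obtain P where P: "P \<in> prob_dists d"
        "\<eta> \<le> measure_pmf.prob (iid_sample n P) {X. ereal s \<le> KL d P (\<Phi> X)}"
      using ex by blast
    have "ereal r \<le> ereal s"
      using that by simp
    hence "{X. ereal s \<le> KL d P (\<Phi> X)} \<subseteq> {X. ereal r \<le> KL d P (\<Phi> X)}"
      by (blast intro: order_trans)
    hence "measure_pmf.prob (iid_sample n P) {X. ereal s \<le> KL d P (\<Phi> X)}
        \<le> measure_pmf.prob (iid_sample n P) {X. ereal r \<le> KL d P (\<Phi> X)}"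
      by (intro measure_pmf.finite_measure_mono) auto
    with P that show ?thesis
      unfolding r_def by (intro bexI[of _ P]) auto
  qed
  show ?thesis
  \<comment> \<open>Let \<open>L = ln d * ln (1 / \<delta>)\<close>. In the first case the numerator
    is at most \<open>101 * L\<close>, and \<open>101 / 5000 \<le> 1 / 8\<close>. In the second it
    is below \<open>1.01 * d\<close>, and \<open>1.01 / 5000 \<le> 1 / 4950\<close> explains the
    constant of \<open>dimension_lower_bound\<close>.\<close>
  proof (cases "real d \<le> 100 * (ln d * ln (1 / \<delta>))")
    case True
    have "r \<le> ln d * ln (1 / \<delta>) / (8 * real n)"
      using True n assms(2) by (simp add: r_def field_simps)
    moreover have "\<delta> \<in> {exp (- real n)<..<1}"
      using assms(3) half by auto
    ultimately show ?thesis
      using confidence_lower_bound[OF n assms(2) _ assms(4)] by (intro weaken[of \<delta>]) auto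
  next
    case False
    have "r \<le> real d / (4950 * real n)"
      using False n by (simp add: r_def field_simps)
    thus ?thesis
      using dimension_lower_bound[OF assms(1,2,4)] assms(3) half by (intro weaken[of "1 / 2"]) auto
  qed
qed

end
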